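(* Let $\alpha_1,\alpha_3,\alpha_4\in\mathbb{F}_{p^m}^*$ be such that $\alpha=\alpha_1+\alpha_3v+\alpha_4uv$ is not a cube in $\mathcal{R}$. Let $0\le\ell\le2p^s-1$ and let $\mathcal{C}=\langle u(x^3-\alpha_0)^\ell\rangle\subseteq\frac{\mathcal{R}[x]}{\langle x^{3p^s}-\alpha\rangle}$ be the corresponding $\alpha$-constacyclic code of length $3p^s$ over $\mathcal{R}$. Then $\mathcal{C}^\perp=\langle(x^3-\alpha_0^{-1})^{2p^s-\ell},\,u\rangle$, as an ideal of $\frac{\mathcal{R}[x]}{\langle x^{3p^s}-\alpha^{-1}\rangle}$.
   Context: $p\neq3$ is a prime, $m,s$ are positive integers, and $\mathcal{R}=\frac{\mathbb{F}_{p^m}[u,v]}{\langle u^2,v^2,uv-vu\rangle}=\mathbb{F}_{p^m}+u\mathbb{F}_{p^m}+v\mathbb{F}_{p^m}+uv\mathbb{F}_{p^m}$ with $u^2=v^2=0$, $uv=vu$. Writing $s=q_0m+r_0$ with $q_0\ge0$ and $0\le r_0\le m-1$, put $\alpha_0=\alpha_1^{p^{m-r_0}}$, so that $\alpha_0^{p^s}=\alpha_1$. A vector $(c_0,\dots,c_{n-1})\in\mathcal{R}^n$, $n=3p^s$, is identified with $c_0+c_1x+\dots+c_{n-1}x^{n-1}$; under this identification $\alpha$-constacyclic codes of length $3p^s$ are the ideals of $\frac{\mathcal{R}[x]}{\langle x^{3p^s}-\alpha\rangle}$. $\mathcal{C}^\perp$ is the dual of $\mathcal{C}$ with respect to the standard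 inner product on $\mathcal{R}^n$; it is an $\alpha^{-1}$-constacyclic code, i.e. an ideal of $\frac{\mathcal{R}[x]}{\langle x^{3p^s}-\alpha^{-1}\rangle}$. *)

theory Defs
  imports
    "HOL-Algebra.Algebraic_Closure_Type"
    "HOL-Algebra.QuotRing"
    "HOL-Computational_Algebra.Polynomial"
begin

section \<open>The ring R = F[u,v] / (u^2, v^2, uv - vu)\<close>

text \<open>\<open>UV a b c d\<close> stands for \<open>a + b u + c v + d u v\<close>.\<close>

datatype 'a uv = UV 'a 'a 'a 'a

instantiation uv :: (comm_ring_1) comm_ring_1
begin

definition "0 = UV 0 0 0 0"

definition "1 = UV 1 0 0 0"

fun plus_uv where
  "UV a b c d + UV a' b' c' d' = UV (a + a') (b + b') (c + c') (d + d')"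

fun minus_uv where
  "UV a b c d - UV a' b' c' d' = UV (a - a') (b - b') (c - c') (d - d')"

fun uminus_uv where
  "- UV a b c d = UV (- a) (- b) (- c) (- d)"

fun times_uv where
  "UV a b c d * UV a' b' c' d' =
     UV (a * a') (a * b' + b * a') (a * c' + c * a') (a * d' + b * c' + c * b' + d * a')"

instance
proof
  fix x y z :: "'a uv"
  show "x + y + z = x + (y + z)"
    by (cases x; cases y; cases z) (simp add: algebra_simps)
  show "x + y = y + x"
    by (cases x; cases y) (simp add: algebra_simps)
  show "0 + x = x"
    by (cases x) (simp add: zero_uv_def)
  show "- x + x = 0"
    by (cases x) (simp add: zero_uv_def)
  show "x - y = x + - y"
    by (cases x; cases y) simp
  show "x * y * z = x * (y * z)"
    by (cases x; cases y; cases z) (simp add: algebra_simps)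
  show "x * y = y * x"
    by (cases x; cases y) (simp add: algebra_simps)
  show "1 * x = x"
    by (cases x) (simp add: one_uv_def)
  show "(x + y) * z = x * z + y * z"
    by (cases x; cases y; cases z) (simp add: algebra_simps)
  show "(0 :: 'a uv) \<noteq> 1"
    by (simp add: zero_uv_def one_uv_def)
qed

end

definition scalar :: "'a::comm_ring_1 \<Rightarrow> 'a uv"
  where "scalar a = UV a 0 0 0"

definition uu :: "'a::comm_ring_1 uv"
  where "uu = UV 0 1 0 0"

definition vv :: "'a::comm_ring_1 uv"
  where "vv = UV 0 0 1 0"

lemma UV_expand:
  "UV a b c d = scalar a + scalar b * uu + scalar c * vv + scalar d * (uu * vv)"
  by (simp add: scalar_def uu_def vv_def)

text \<open>
  The next definition and lemmas identify \<^typ>\<open>'a uv\<close> with the quotient of \<open>F[u,v] = F[u][v]\<close>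
  by the ideal generated by \<open>u^2\<close> and \<open>v^2\<close>. In \<^typ>\<open>'a poly poly\<close> the inner
  indeterminate is \<open>u\<close> and the outer one is \<open>v\<close>.
\<close>

definition uv_of_poly :: "'a::comm_ring_1 poly poly \<Rightarrow> 'a uv" where
  "uv_of_poly P =
     UV (Polynomial.coeff (Polynomial.coeff P 0) 0) (Polynomial.coeff (Polynomial.coeff P 0) 1)
        (Polynomial.coeff (Polynomial.coeff P 1) 0) (Polynomial.coeff (Polynomial.coeff P 1) 1)"

lemma uv_of_poly_hom:
  "uv_of_poly 1 = 1"
  "uv_of_poly (P + Q) = uv_of_poly P + uv_of_poly Q"
  "uv_of_poly (P * Q) = uv_of_poly P * uv_of_poly Q"
  "uv_of_poly [:[:a:]:] = scalar a"
  "uv_of_poly [:[:0, 1:]:] = uu"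
  "uv_of_poly [:0, 1:] = vv"
  by (simp_all add: uv_of_poly_def one_uv_def scalar_def uu_def vv_def Polynomial.coeff_mult
      algebra_simps)

lemma surj_uv_of_poly: "surj uv_of_poly"
proof (rule surjI)
  fix x :: "'a uv"
  show "uv_of_poly (case x of UV a b c d \<Rightarrow> [:[:a, b:], [:c, d:]:]) = x"
    by (cases x) (simp add: uv_of_poly_def)
qed

lemma uv_of_poly_eq_0_iff:
  "uv_of_poly P = 0 \<longleftrightarrow> (\<exists>A B. P = A * [:[:0, 0, 1:]:] + B * [:0, 0, 1:])"
proof
  assume P: "uv_of_poly P = 0"
  obtain p0 p1 B where PB: "P = pCons p0 (pCons p1 B)" by (metis pCons_cases)
  obtain a b p0' where p0: "p0 = pCons a (pCons b p0')" by (metis pCons_cases)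
  obtain c d p1' where p1: "p1 = pCons c (pCons d p1')" by (metis pCons_cases)
  have "a = 0" "b = 0" "c = 0" "d = 0"
    using P by (auto simp: uv_of_poly_def zero_uv_def PB p0 p1)
  then have "P = [:p0', p1':] * [:[:0, 0, 1:]:] + B * [:0, 0, 1:]"
    by (simp add: PB p0 p1)
  then show "\<exists>A B. P = A * [:[:0, 0, 1:]:] + B * [:0, 0, 1:]" by blast
next
  assume "\<exists>A B. P = A * [:[:0, 0, 1:]:] + B * [:0, 0, 1:]"
  then show "uv_of_poly P = 0"
    by (auto simp: uv_of_poly_def zero_uv_def Polynomial.coeff_mult)
qed


section \<open>Constacyclic codes\<close>

definition modulus :: "nat \<Rightarrow> 'r::comm_ring_1 \<Rightarrow> 'r poly set"
  where "modulus n a = PIdl\<^bsub>ring_of_type_algebra\<^esub> (Polynomial.monom 1 n - [:a:])"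

definition quot_ring :: "nat \<Rightarrow> 'r::comm_ring_1 \<Rightarrow> 'r poly set ring"
  where "quot_ring n a = ring_of_type_algebra Quot modulus n a"

text \<open>The residue class of \<open>f\<close> in \<open>R[x]/(x^n - a)\<close>.\<close>

definition cls :: "nat \<Rightarrow> 'r::comm_ring_1 \<Rightarrow> 'r poly \<Rightarrow> 'r poly set"
  where "cls n a f = modulus n a +>\<^bsub>ring_of_type_algebra\<^esub> f"

text \<open>The ideal of \<open>R[x]/(x^n - a)\<close> generated by the residue classes of the polynomials in \<open>S\<close>.\<close>

definition ideal_gen :: "nat \<Rightarrow> 'r::comm_ring_1 \<Rightarrow> 'r poly set \<Rightarrow> 'r poly set set"
  where "ideal_gen n a S = Idl\<^bsub>quot_ring n a\<^esub> (cls n a ` S)"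

text \<open>Vectors of length \<open>n\<close> are lists; \<^term>\<open>Poly c\<close> is \<open>c\<^sub>0 + c\<^sub>1 x + \<dots> + c\<^sub>n\<^sub>-\<^sub>1 x\<^sup>n\<^sup>-\<^sup>1\<close>.\<close>

definition code_of_ideal :: "nat \<Rightarrow> 'r::comm_ring_1 \<Rightarrow> 'r poly set set \<Rightarrow> 'r list set"
  where "code_of_ideal n a I = {c. length c = n \<and> cls n a (Poly c) \<in> I}"

definition dual_code :: "nat \<Rightarrow> 'r::comm_ring_1 list set \<Rightarrow> 'r list set"
  where "dual_code n C = {b. length b = n \<and> (\<forall>c\<in>C. (\<Sum>i<n. b ! i * c ! i) = 0)}"

text \<open>Only meaningful for units; \<open>a + b u + c v + d u v\<close> with \<open>a \<noteq> 0\<close> is one over a field.\<close>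

definition ring_inv :: "'r::comm_ring_1 \<Rightarrow> 'r"
  where "ring_inv a = inv\<^bsub>ring_of_type_algebra\<^esub> a"

lemma ring_inv_eqI:
  assumes "a * b = (1 :: 'r::comm_ring_1)"
  shows "ring_inv a = b"
proof -
  interpret cring "ring_of_type_algebra :: 'r ring"
    by (rule cring_from_type_algebra)
  show ?thesis
    unfolding ring_inv_def
    by (rule comm_inv_char) (use assms in \<open>auto simp: ring_of_type_algebra_def\<close>)
qed

end

theory Submission
  imports Defs "HOL-Number_Theory.Residues"
begin

text \<open>
  Write \<open>R\<close> for the ring \<open>F[u,v]/(u^2, v^2)\<close> and \<open>n = 3 p^s\<close>. The theorem is the combination of
  a duality statement, valid over every commutative ring, and the computation of one annihilator.

  Duality. Transposing multiplication by \<open>x\<close> on \<open>R[x]/(x^n - \<alpha>)\<close> with respect to the standard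
  inner product gives multiplication by \<open>1/x = \<alpha> x^(n-1)\<close> on \<open>R[x]/(x^n - 1/\<alpha>)\<close>. So a word
  \<open>b\<close> is orthogonal to all multiples of \<open>g\<close> iff \<open>g(1/x) b = 0\<close>: the dual of the principal code
  \<open>\<langle>g\<rangle>\<close> is the annihilator of \<open>g(1/x)\<close> (\<open>dual_code_principal\<close>). For \<open>g = u (x^3 - \<alpha>\<^sub>0)^l\<close> the
  element \<open>g(1/x)\<close> is a unit times \<open>u (x^3 - 1/\<alpha>\<^sub>0)^l\<close> (\<open>reciprocal_substitution\<close>).

  Annihilator. Put \<open>P = x^3 - 1/\<alpha>\<^sub>0\<close> and \<open>q = p^s\<close>. By Frobenius \<open>P^q = x^n - 1/\<alpha>\<^sub>1\<close>, and
  \<open>1/\<alpha> = 1/\<alpha>\<^sub>1 + b v + c u v\<close> with \<open>b \<noteq> 0\<close>. An element is killed by \<open>u P^l\<close> iff \<open>P^l\<close> kills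
  it modulo \<open>u\<close>, and modulo \<open>u\<close> the residue ring is \<open>F[v][x]/(v^2, P^q - b v)\<close>. There
  \<open>v = P^q/b\<close> can be eliminated, which leaves \<open>F[x]/(P^(2q))\<close>. In this ring the annihilator of \<open>P^l\<close> is generated by \<open>P^(2q-l)\<close>; hence that of \<open>u P^l\<close> is
  \<open>\<langle>P^(2q-l), u\<rangle>\<close> (\<open>annihilator_uu_power\<close>).
\<close>

section \<open>Ideals generated in the residue ring\<close>

text \<open>
  Over the polynomial ring as a module over itself, submodules are ideals, so that the span of a
  finite set is an explicit set of combinations.
\<close>

interpretation poly_span: Modules.module "(*) :: 'r::comm_ring_1 poly \<Rightarrow> 'r poly \<Rightarrow> 'r poly"
  by unfold_locales (simp_all add: algebra_simps)

text \<open>With multiplication as the scaling, this rule reverses \<open>mult.assoc\<close>, and rewriting would loop.\<close>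

declare poly_span.scale_scale [simp del]

abbreviation xn_minus :: "nat \<Rightarrow> 'r::comm_ring_1 \<Rightarrow> 'r poly"
  where "xn_minus n a \<equiv> Polynomial.monom 1 n - [:a:]"

lemma ideal_modulus:
  "ideal (modulus n (a :: 'r::comm_ring_1)) ring_of_type_algebra"
proof -
  interpret cring "ring_of_type_algebra :: 'r poly ring"
    by (rule cring_from_type_algebra)
  show ?thesis
    unfolding modulus_def by (rule cgenideal_ideal) (simp add: ring_of_type_algebra_def)
qed

lemma mem_modulus_iff:
  "f \<in> modulus n (a :: 'r::comm_ring_1) \<longleftrightarrow> xn_minus n a dvd f"
  by (auto simp: modulus_def cgenideal_def ring_of_type_algebra_def dvd_def mult.commute)

lemma cls_altdef: "cls n (a :: 'r::comm_ring_1) f = {g. xn_minus n a dvd g - f}"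
proof -
  have "cls n a f = (\<lambda>h. h + f) ` {h. xn_minus n a dvd h}"
    using mem_modulus_iff[of _ n a]
    by (auto simp: cls_def a_r_coset_def' ring_of_type_algebra_def)
  also have "\<dots> = {g. xn_minus n a dvd g - f}"
  proof (intro equalityI subsetI)
    show "g \<in> (\<lambda>h. h + f) ` {h. xn_minus n a dvd h}" if "g \<in> {g. xn_minus n a dvd g - f}" for g
      using that by (intro image_eqI[of _ _ "g - f"]) auto
  qed auto
  finally show ?thesis .
qed

lemma cls_eq_iff:
  "cls n (a :: 'r::comm_ring_1) f = cls n a g \<longleftrightarrow> xn_minus n a dvd f - g"
proof
  assume "cls n a f = cls n a g"
  then have "f \<in> cls n a g" by (auto simp: cls_altdef)
  then show "xn_minus n a dvd f - g" by (simp add: cls_altdef)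
next
  assume *: "xn_minus n a dvd f - g"
  have "xn_minus n a dvd h - f \<longleftrightarrow> xn_minus n a dvd h - g" for h
    using dvd_add_left_iff[OF *, of "h - f"] by simp
  then show "cls n a f = cls n a g" by (simp add: cls_altdef)
qed

text \<open>
  Ideals of a quotient correspond to ideals of the polynomial ring that contain the modulus. This
  replaces membership in an ideal of cosets by divisibility between polynomials.
\<close>

lemma cls_mem_ideal_gen_iff:
  "cls n (a :: 'r::comm_ring_1) f \<in> ideal_gen n a S \<longleftrightarrow> f \<in> poly_span.span (insert (xn_minus n a) S)"
    (is "_ \<longleftrightarrow> f \<in> ?K")
proof -
  let ?T = "ring_of_type_algebra :: 'r poly ring" and ?R = "quot_ring n a"
  interpret hom: ring_hom_ring ?T ?R "cls n a"
    using ideal.rcos_ring_hom_ring[OF ideal_modulus]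
    by (simp add: quot_ring_def cls_def[abs_def])
  have carT: "carrier ?T = UNIV" by (simp add: ring_of_type_algebra_def)
  have opsT: "x \<oplus>\<^bsub>?T\<^esub> y = x + y" "x \<otimes>\<^bsub>?T\<^esub> y = x * y" "\<zero>\<^bsub>?T\<^esub> = 0" for x y
    by (simp_all add: ring_of_type_algebra_def)
  have add: "cls n a (x + y) = cls n a x \<oplus>\<^bsub>?R\<^esub> cls n a y" for x y
    using hom.hom_add[of x y] by (simp add: carT opsT)
  have mult: "cls n a (x * y) = cls n a x \<otimes>\<^bsub>?R\<^esub> cls n a y" for x y
    using hom.hom_mult[of x y] by (simp add: carT opsT)
  have zero: "cls n a 0 = \<zero>\<^bsub>?R\<^esub>"
    using hom.hom_zero by (simp add: opsT)
  have carR: "carrier ?R = range (cls n a)"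
    by (auto simp: quot_ring_def FactRing_def A_RCOSETS_def RCOSETS_def cls_def a_r_coset_def
        ring_of_type_algebra_def)
  have S: "cls n a ` S \<subseteq> carrier ?R" using carR by auto
  have idl: "ideal (ideal_gen n a S) ?R"
    unfolding ideal_gen_def by (rule hom.S.genideal_ideal[OF S])
  have QK: "xn_minus n a \<in> ?K" by (simp add: poly_span.span_base)
  have K_cong: "x \<in> ?K" if "y \<in> ?K" "cls n a x = cls n a y" for x y
  proof -
    from that(2) obtain k where "x - y = xn_minus n a * k"
      unfolding cls_eq_iff by (rule dvdE)
    then have "x = y + k * xn_minus n a"
      by (simp only: diff_eq_eq add.commute[of y] mult.commute[of k])
    then show ?thesis
      using poly_span.span_add[OF that(1) poly_span.span_scale[OF QK]] by (simp only:)
  qed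
  have "ideal (cls n a ` ?K) ?R"
  proof (rule idealI[OF hom.S.ring_axioms])
    show "subgroup (cls n a ` ?K) (add_monoid ?R)"
    proof (rule hom.S.add.subgroupI)
      show "cls n a ` ?K \<subseteq> carrier ?R" using carR by auto
      show "cls n a ` ?K \<noteq> {}" using QK by auto
      show "\<ominus>\<^bsub>?R\<^esub> x \<in> cls n a ` ?K" if "x \<in> cls n a ` ?K" for x
      proof -
        from that obtain f where f: "f \<in> ?K" "x = cls n a f" by auto
        have "cls n a (- f) \<oplus>\<^bsub>?R\<^esub> x = \<zero>\<^bsub>?R\<^esub>" using add[of "- f" f] f zero by simp
        then have "\<ominus>\<^bsub>?R\<^esub> x = cls n a (- f)"
          using f carR by (metis hom.S.minus_equality rangeI)
        then show ?thesis using f poly_span.span_neg by blast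
      qed
      show "x \<oplus>\<^bsub>?R\<^esub> y \<in> cls n a ` ?K" if "x \<in> cls n a ` ?K" "y \<in> cls n a ` ?K" for x y
        using that by (auto simp: poly_span.span_add simp flip: add)
    qed
    fix x y
    assume "y \<in> cls n a ` ?K" "x \<in> carrier ?R"
    then obtain f g where fg: "f \<in> ?K" "y = cls n a f" "x = cls n a g" using carR by auto
    then have "g * f \<in> ?K" "f * g \<in> ?K"
      using poly_span.span_scale[OF fg(1), of g] by (simp_all add: mult.commute)
    then show "x \<otimes>\<^bsub>?R\<^esub> y \<in> cls n a ` ?K" "y \<otimes>\<^bsub>?R\<^esub> x \<in> cls n a ` ?K"
      unfolding fg(2,3) mult[symmetric] by blast+
  qed
  then have sub: "ideal_gen n a S \<subseteq> cls n a ` ?K"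
    unfolding ideal_gen_def
    by (rule hom.S.genideal_minimal) (auto intro: poly_span.span_base)
  have "?K \<subseteq> {f. cls n a f \<in> ideal_gen n a S}"
  proof (rule poly_span.span_minimal)
    have "cls n a (xn_minus n a) = cls n a 0" by (simp add: cls_eq_iff)
    then have "cls n a (xn_minus n a) \<in> ideal_gen n a S"
      using zero additive_subgroup.zero_closed[OF ideal.axioms(1)[OF idl]] by simp
    moreover have "cls n a ` S \<subseteq> ideal_gen n a S"
      unfolding ideal_gen_def by (rule hom.S.genideal_self[OF S])
    ultimately show "insert (xn_minus n a) S \<subseteq> {f. cls n a f \<in> ideal_gen n a S}" by auto
    show "poly_span.subspace {f. cls n a f \<in> ideal_gen n a S}"
    proof (rule poly_span.subspaceI)
      show "0 \<in> {f. cls n a f \<in> ideal_gen n a S}"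
        using zero additive_subgroup.zero_closed[OF ideal.axioms(1)[OF idl]] by simp
      show "x + y \<in> {f. cls n a f \<in> ideal_gen n a S}"
        if "x \<in> {f. cls n a f \<in> ideal_gen n a S}" "y \<in> {f. cls n a f \<in> ideal_gen n a S}" for x y
        using that additive_subgroup.a_closed[OF ideal.axioms(1)[OF idl]] by (simp add: add)
      show "c * x \<in> {f. cls n a f \<in> ideal_gen n a S}"
        if "x \<in> {f. cls n a f \<in> ideal_gen n a S}" for c x
        using that ideal.I_l_closed[OF idl] carR by (simp add: mult)
    qed
  qed
  then show ?thesis using sub K_cong by blast
qed

lemma mem_span_insert_modulus_iff:
  "f \<in> poly_span.span (insert q S) \<longleftrightarrow> (\<exists>h\<in>poly_span.span S. q dvd f - h)"
  unfolding poly_span.span_breakdown_eq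
proof
  assume "\<exists>k. f - k * q \<in> poly_span.span S"
  then obtain k where "f - k * q \<in> poly_span.span S" ..
  moreover have "q dvd f - (f - k * q)" by simp
  ultimately show "\<exists>h\<in>poly_span.span S. q dvd f - h" by blast
next
  assume "\<exists>h\<in>poly_span.span S. q dvd f - h"
  then obtain h k where "h \<in> poly_span.span S" "f - h = q * k" by (auto elim: dvdE)
  moreover from this have "h = f - k * q" by (simp add: algebra_simps)
  ultimately show "\<exists>k. f - k * q \<in> poly_span.span S" by blast
qed

lemma mem_span_pair_iff:
  "x \<in> poly_span.span {f, g} \<longleftrightarrow> (\<exists>c d. x = c * f + d * g)"
proof
  assume "x \<in> poly_span.span {f, g}"
  then obtain c d where "x - c * f = d * g"
    unfolding poly_span.span_breakdown_eq[of x f] poly_span.span_singleton by blast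
  then have "x = c * f + d * g" by (simp add: algebra_simps)
  then show "\<exists>c d. x = c * f + d * g" by blast
next
  assume "\<exists>c d. x = c * f + d * g"
  then show "x \<in> poly_span.span {f, g}"
    using poly_span.span_base[of f "{f, g}"] poly_span.span_base[of g "{f, g}"]
    by (metis insertI1 insertI2 poly_span.span_add poly_span.span_scale)
qed

section \<open>Duals of principal constacyclic codes\<close>

text \<open>
  A word \<open>b\<close> of length \<open>n\<close> is extended to the sequence \<open>\<beta>\<close> with \<open>\<beta> (k + n) = a \<beta> k\<close>. Then
  \<open>x^k \<mapsto> \<beta> k\<close> defines a linear functional on polynomials that vanishes on multiples of \<open>x^n - a\<close> and
  is the inner product with \<open>b\<close> on polynomials of degree below \<open>n\<close>, so that orthogonality
  of words can be tested without reducing modulo \<open>x^n - a\<close>.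
\<close>

definition pairing :: "(nat \<Rightarrow> 'r) \<Rightarrow> 'r::comm_ring_1 poly \<Rightarrow> 'r"
  where "pairing \<beta> f = (\<Sum>k\<le>Polynomial.degree f. Polynomial.coeff f k * \<beta> k)"

lemma pairing_eq_sum_lessThan:
  assumes "\<And>k. k \<ge> N \<Longrightarrow> Polynomial.coeff f k = 0"
  shows "pairing \<beta> f = (\<Sum>k<N. Polynomial.coeff f k * \<beta> k)"
  unfolding pairing_def
proof (rule sum.mono_neutral_cong)
  show "Polynomial.coeff f i * \<beta> i = 0" if "i \<in> {..<N} - {..Polynomial.degree f}" for i
    using that by (simp add: Polynomial.coeff_eq_0)
  show "Polynomial.coeff f i * \<beta> i = 0" if "i \<in> {..Polynomial.degree f} - {..<N}" for i
    using that assms by simp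
qed auto

lemma pairing_0 [simp]: "pairing \<beta> 0 = 0"
  by (simp add: pairing_def)

lemma pairing_pCons:
  "pairing \<beta> (pCons c f) = c * \<beta> 0 + pairing (\<lambda>k. \<beta> (Suc k)) f"
proof -
  have "pairing \<beta> (pCons c f)
      = (\<Sum>k<Suc (Suc (Polynomial.degree f)). Polynomial.coeff (pCons c f) k * \<beta> k)"
    by (rule pairing_eq_sum_lessThan) (simp add: Polynomial.coeff_eq_0 coeff_pCons split: nat.split)
  also have "\<dots> = c * \<beta> 0 + (\<Sum>k<Suc (Polynomial.degree f). Polynomial.coeff f k * \<beta> (Suc k))"
    by (subst sum.lessThan_Suc_shift) simp
  also have "(\<Sum>k<Suc (Polynomial.degree f). Polynomial.coeff f k * \<beta> (Suc k))
      = pairing (\<lambda>k. \<beta> (Suc k)) f"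
    by (rule pairing_eq_sum_lessThan[symmetric]) (simp add: Polynomial.coeff_eq_0)
  finally show ?thesis .
qed

lemma pairing_add: "pairing \<beta> (f + g) = pairing \<beta> f + pairing \<beta> g"
proof (induction f g arbitrary: \<beta> rule: poly_induct2)
  case (pCons a p b q)
  then show ?case by (simp add: pairing_pCons algebra_simps)
qed simp

lemma pairing_smult: "pairing \<beta> (smult c f) = c * pairing \<beta> f"
  by (induction f arbitrary: \<beta>) (auto simp: pairing_pCons algebra_simps)

lemma pairing_diff: "pairing \<beta> (f - g) = pairing \<beta> f - pairing \<beta> g"
  using pairing_add[of \<beta> "f - g" g] by simp

lemma pairing_scale: "pairing (\<lambda>k. c * \<beta> k) f = c * pairing \<beta> f"
  by (induction f arbitrary: \<beta>) (auto simp: pairing_pCons algebra_simps)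

lemma pairing_zero_seq [simp]: "pairing (\<lambda>k. 0) f = 0"
  by (simp add: pairing_def)

lemma pairing_monom: "pairing \<beta> (Polynomial.monom c j) = c * \<beta> j"
  by (induction j arbitrary: \<beta>) (simp_all add: monom_0 monom_Suc pairing_pCons)

text \<open>The action of \<open>R[x]\<close> on sequences in which \<open>x\<close> is the left shift.\<close>

definition seq_act :: "'r::comm_ring_1 poly \<Rightarrow> (nat \<Rightarrow> 'r) \<Rightarrow> nat \<Rightarrow> 'r"
  where "seq_act f \<beta> j = pairing (\<lambda>k. \<beta> (k + j)) f"

lemma seq_act_pCons: "seq_act (pCons c f) \<beta> j = c * \<beta> j + seq_act f (\<lambda>k. \<beta> (Suc k)) j"
  by (simp add: seq_act_def pairing_pCons)

text \<open>
  The shift action is adjoint to multiplication: the functional of \<open>\<beta>\<close> vanishes on the ideal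
  generated by \<open>g\<close> iff \<open>g\<close> annihilates \<open>\<beta>\<close>.
\<close>

lemma pairing_mult: "pairing \<beta> (g * h) = pairing (seq_act g \<beta>) h"
proof (induction h arbitrary: \<beta>)
  case (pCons c h)
  have "pairing \<beta> (g * pCons c h) = c * seq_act g \<beta> 0 + pairing (\<lambda>k. \<beta> (Suc k)) (g * h)"
    by (simp add: pairing_add pairing_smult pairing_pCons seq_act_def)
  also have "pairing (\<lambda>k. \<beta> (Suc k)) (g * h) = pairing (\<lambda>j. seq_act g \<beta> (Suc j)) h"
    unfolding pCons.IH by (simp add: seq_act_def[abs_def])
  finally show ?case by (simp add: pairing_pCons)
qed simp

definition quasi_periodic :: "nat \<Rightarrow> 'r::comm_ring_1 \<Rightarrow> (nat \<Rightarrow> 'r) \<Rightarrow> bool"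
  where "quasi_periodic n a \<beta> \<longleftrightarrow> (\<forall>k. \<beta> (k + n) = a * \<beta> k)"

lemma quasi_periodic_shift:
  "quasi_periodic n a \<beta> \<Longrightarrow> quasi_periodic n a (\<lambda>k. \<beta> (Suc k))"
  unfolding quasi_periodic_def by (metis add_Suc)

lemma quasi_periodic_seq_act:
  assumes "quasi_periodic n a \<beta>"
  shows "quasi_periodic n a (seq_act g \<beta>)"
  using assms
  by (simp add: quasi_periodic_def seq_act_def flip: add.assoc pairing_scale)

lemma quasi_periodic_eq_0_iff:
  assumes "quasi_periodic n a \<beta>" "n > 0"
  shows "(\<forall>j. \<beta> j = 0) \<longleftrightarrow> (\<forall>j<n. \<beta> j = 0)"
proof (intro iffI allI)
  fix j assume *: "\<forall>j<n. \<beta> j = 0"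
  show "\<beta> j = 0"
  proof (induction j rule: less_induct)
    case (less j)
    show ?case
    proof (cases "j < n")
      case False
      then have "\<beta> j = a * \<beta> (j - n)"
        using assms(1) by (metis quasi_periodic_def le_add_diff_inverse2 not_less)
      then show ?thesis using less[of "j - n"] False assms(2) by simp
    qed (use * in simp)
  qed
qed simp

lemma pairing_multiple_modulus:
  assumes "quasi_periodic n a \<beta>" "xn_minus n a dvd f"
  shows "pairing \<beta> f = 0"
proof -
  have "seq_act (xn_minus n a) \<beta> = (\<lambda>j. 0)"
    using assms(1)
    by (simp add: fun_eq_iff seq_act_def pairing_diff pairing_monom pairing_pCons
        quasi_periodic_def add.commute[of n])
  with assms(2) show ?thesis by (auto simp: dvd_def pairing_mult)
qed

text \<open>
  The way back from sequences to words. Truncation identifies quasi-periodic sequences with residue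
  classes modulo \<open>x^n - a'\<close>, where \<open>a' = 1/a\<close>.
\<close>

definition truncation :: "nat \<Rightarrow> (nat \<Rightarrow> 'r) \<Rightarrow> 'r::comm_ring_1 poly"
  where "truncation n \<beta> = (\<Sum>j<n. Polynomial.monom (\<beta> j) j)"

lemma coeff_truncation: "Polynomial.coeff (truncation n \<beta>) j = (if j < n then \<beta> j else 0)"
  by (auto simp: truncation_def Polynomial.coeff_sum)

text \<open>The modulus is monic of degree \<open>n\<close>, so it has no nonzero multiple of smaller degree.\<close>

lemma modulus_dvd_truncation_iff:
  assumes "n > 0"
  shows "xn_minus n a dvd truncation n \<beta> \<longleftrightarrow> (\<forall>j<n. \<beta> j = 0)"
proof
  assume "xn_minus n a dvd truncation n \<beta>"
  then obtain k where k: "truncation n \<beta> = xn_minus n a * k" by (auto simp: dvd_def)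
  have "k = 0"
  proof (rule ccontr)
    assume "k \<noteq> 0"
    let ?d = "Polynomial.degree k"
    have "Polynomial.coeff (xn_minus n a * k) (n + ?d) = lead_coeff k"
      using assms by (simp add: left_diff_distrib coeff_monom_mult Polynomial.coeff_eq_0)
    then show False using k \<open>k \<noteq> 0\<close> coeff_truncation[of n \<beta> "n + ?d"] by simp
  qed
  then have "truncation n \<beta> = 0" using k by simp
  then show "\<forall>j<n. \<beta> j = 0" using coeff_truncation[of n \<beta>] by (metis Polynomial.coeff_0)
next
  assume "\<forall>j<n. \<beta> j = 0"
  then have "truncation n \<beta> = 0" by (simp add: truncation_def)
  then show "xn_minus n a dvd truncation n \<beta>" by simp
qed

text \<open>Modulo \<open>x^n - 1/a\<close> the inverse of \<open>x\<close> is \<open>a x^(n-1)\<close>, because \<open>a x^n = 1\<close>.\<close>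

lemma x_times_inverse:
  assumes "a * a' = (1 :: 'r::comm_ring_1)" "n > 0"
  shows "xn_minus n a' dvd Polynomial.monom a (n - 1) * [:0, 1:] - 1"
proof -
  have "Polynomial.monom a (n - 1) * [:0, 1:] = Polynomial.monom a n"
    using assms(2) by (cases n) (simp_all add: monom_Suc)
  then have "Polynomial.monom a (n - 1) * [:0, 1:] - 1 = [:a:] * xn_minus n a'"
    using assms(1) by (simp add: smult_monom smult_diff_right one_pCons)
  then show ?thesis by (metis dvd_triv_right)
qed

text \<open>
  Multiplying the truncation of the shifted sequence by \<open>x\<close> restores all entries but the first,
  and adds \<open>\<beta> n x^n = a (\<beta> 0) x^n\<close>, which is \<open>\<beta> 0\<close> in the residue ring. So the shift is division by \<open>x\<close>.
\<close>

lemma truncation_shift: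
  assumes "quasi_periodic n a \<beta>" "a * a' = (1 :: 'r::comm_ring_1)" "n > 0"
  shows "xn_minus n a' dvd truncation n (\<lambda>k. \<beta> (Suc k)) - Polynomial.monom a (n - 1) * truncation n \<beta>"
proof -
  let ?Q = "xn_minus n a'" and ?y = "Polynomial.monom a (n - 1)" and ?s = "truncation n (\<lambda>k. \<beta> (Suc k))"
  have "[:0, 1:] * ?s = (\<Sum>j<n. Polynomial.monom (\<beta> (Suc j)) (Suc j))"
    by (simp add: truncation_def monom_Suc sum_distrib_left)
  also have "\<dots> = (\<Sum>j<Suc n. Polynomial.monom (\<beta> j) j) - [:\<beta> 0:]"
    by (subst sum.lessThan_Suc_shift) (simp add: monom_0)
  also have "\<dots> = truncation n \<beta> + (Polynomial.monom (a * \<beta> 0) n - [:\<beta> 0:])"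
    using assms(1)[unfolded quasi_periodic_def, rule_format, of 0] by (simp add: truncation_def)
  also have "Polynomial.monom (a * \<beta> 0) n - [:\<beta> 0:] = [:a * \<beta> 0:] * ?Q"
    using assms(2) by (simp add: smult_monom smult_diff_right mult.left_commute[of a "\<beta> 0"] mult.assoc)
  finally have *: "truncation n \<beta> = [:0, 1:] * ?s - [:a * \<beta> 0:] * ?Q" by simp
  have "?s - ?y * truncation n \<beta> = ?y * [:a * \<beta> 0:] * ?Q - (?y * [:0, 1:] - 1) * ?s"
    unfolding * by (simp only: algebra_simps mult_1_left)
  then show ?thesis
    using x_times_inverse[OF assms(2,3)] by (metis dvd_diff dvd_mult dvd_mult2 dvd_refl)
qed

text \<open>The same for an arbitrary polynomial in the shift: it acts as that polynomial in \<open>1/x\<close>.\<close>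

lemma truncation_act:
  assumes "quasi_periodic n a \<beta>" "a * a' = (1 :: 'r::comm_ring_1)" "n > 0"
  shows "xn_minus n a' dvd truncation n (seq_act f \<beta>) - pcompose f (Polynomial.monom a (n - 1)) * truncation n \<beta>"
  using assms(1)
proof (induction f arbitrary: \<beta>)
  case 0
  then show ?case by (simp add: truncation_def seq_act_def)
next
  case (pCons c f)
  let ?y = "Polynomial.monom a (n - 1)" and ?s = "\<lambda>k. \<beta> (Suc k)"
  let ?F = "pcompose f ?y"
  have "truncation n (seq_act (pCons c f) \<beta>) = [:c:] * truncation n \<beta> + truncation n (seq_act f ?s)"
    by (intro Polynomial.poly_eqI) (simp add: coeff_truncation seq_act_pCons)
  then have "truncation n (seq_act (pCons c f) \<beta>) - pcompose (pCons c f) ?y * truncation n \<beta>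
      = (truncation n (seq_act f ?s) - ?F * truncation n ?s) + ?F * (truncation n ?s - ?y * truncation n \<beta>)"
    by (simp only: pcompose_pCons algebra_simps)
  then show ?case
    using pCons.IH[OF quasi_periodic_shift[OF pCons.prems]] truncation_shift[OF pCons.prems assms(2,3)]
    by (metis dvd_add dvd_mult)
qed

lemma exists_word_representative:
  fixes f :: "'r::comm_ring_1 poly"
  assumes "n > 0"
  shows "\<exists>c. length c = n \<and> xn_minus n a dvd Poly c - f"
proof -
  have "\<exists>\<gamma>. xn_minus n a dvd truncation n \<gamma> - f"
  proof (induction f)
    case 0
    have "truncation n (\<lambda>_. 0) = (0 :: 'r poly)" by (simp add: truncation_def)
    then show ?case by (metis diff_zero dvd_0_right)
  next
    case (pCons c f)
    then obtain \<gamma> where \<gamma>: "xn_minus n a dvd truncation n \<gamma> - f" by blast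
    obtain k where n: "n = Suc k" using assms by (cases n) auto
    \<comment> \<open>multiply by \<open>x\<close>, replace \<open>x^n\<close> by \<open>a\<close>, and add \<open>c\<close>\<close>
    define \<delta> where "\<delta> = (\<lambda>j. case j of 0 \<Rightarrow> c + a * \<gamma> k | Suc i \<Rightarrow> \<gamma> i)"
    have "truncation n \<delta> = [:c + a * \<gamma> k:] + [:0, 1:] * truncation k \<gamma>"
      unfolding n truncation_def
      by (subst sum.lessThan_Suc_shift) (simp add: \<delta>_def monom_0 monom_Suc sum_distrib_left)
    moreover have "truncation n \<gamma> = truncation k \<gamma> + Polynomial.monom (\<gamma> k) k"
      by (simp add: truncation_def n)
    moreover have "[:0, 1:] * Polynomial.monom (\<gamma> k) k = [:\<gamma> k:] * xn_minus n a + [:a * \<gamma> k:]"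
      by (simp add: n smult_diff_right smult_monom monom_Suc[symmetric] mult.commute)
    moreover have "pCons c f = [:c:] + [:0, 1:] * f" by simp
    ultimately have "truncation n \<delta> - pCons c f = [:0, 1:] * (truncation n \<gamma> - f) - [:\<gamma> k:] * xn_minus n a"
      by (simp add: algebra_simps)
    then show ?case using \<gamma> by (metis dvd_diff dvd_mult dvd_refl)
  qed
  then obtain \<gamma> where \<gamma>: "xn_minus n a dvd truncation n \<gamma> - f" by blast
  have "Poly (map \<gamma> [0..<n]) = truncation n \<gamma>"
    by (rule Polynomial.poly_eqI) (simp add: coeff_truncation nth_default_def)
  then show ?thesis using \<gamma> by (intro exI[of _ "map \<gamma> [0..<n]"]) simp
qed

text \<open>
  With \<open>\<beta>\<close> the extension of \<open>b\<close>: \<open>b\<close> is orthogonal to \<open>\<langle>g\<rangle>\<close> iff \<open>g\<close> annihilates \<open>\<beta>\<close> under the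
  shift action (adjointness), iff \<open>g(1/x)\<close> annihilates the residue class of \<open>b\<close> (truncation).
\<close>

theorem dual_code_principal:
  fixes a a' :: "'r::comm_ring_1"
  assumes "a * a' = 1" "n > 0"
  shows "dual_code n (code_of_ideal n a (ideal_gen n a {g}))
       = {b. length b = n \<and> xn_minus n a' dvd pcompose g (Polynomial.monom a (n - 1)) * Poly b}"
proof -
  let ?y = "Polynomial.monom a (n - 1)"
  have "(\<forall>c\<in>code_of_ideal n a (ideal_gen n a {g}). (\<Sum>i<n. b ! i * c ! i) = 0)
      \<longleftrightarrow> xn_minus n a' dvd pcompose g ?y * Poly b" if b: "length b = n" for b
  proof -
    define \<beta> where "\<beta> k = a ^ (k div n) * b ! (k mod n)" for k
    have qp: "quasi_periodic n a \<beta>"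
      using assms(2) by (simp add: quasi_periodic_def \<beta>_def mult.assoc)
    have truncation: "truncation n \<beta> = Poly b"
      by (rule Polynomial.poly_eqI) (auto simp: coeff_truncation \<beta>_def nth_default_def b)
    have dot: "pairing \<beta> (Poly c) = (\<Sum>i<n. b ! i * c ! i)" if "length c = n" for c
      by (subst pairing_eq_sum_lessThan[of n])
        (auto simp: nth_default_def \<beta>_def that mult.commute intro!: sum.cong)
    have mem: "c \<in> code_of_ideal n a (ideal_gen n a {g})
        \<longleftrightarrow> length c = n \<and> (\<exists>h. xn_minus n a dvd Poly c - g * h)" for c
      by (auto simp: code_of_ideal_def cls_mem_ideal_gen_iff mem_span_insert_modulus_iff
          poly_span.span_singleton mult.commute)
    have "(\<forall>c\<in>code_of_ideal n a (ideal_gen n a {g}). (\<Sum>i<n. b ! i * c ! i) = 0)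
        \<longleftrightarrow> (\<forall>h. pairing \<beta> (g * h) = 0)"
    proof (intro iffI allI ballI)
      fix h
      assume *: "\<forall>c\<in>code_of_ideal n a (ideal_gen n a {g}). (\<Sum>i<n. b ! i * c ! i) = 0"
      obtain c where c: "length c = n" "xn_minus n a dvd Poly c - g * h"
        using exists_word_representative[OF assms(2)] by blast
      then have "pairing \<beta> (Poly c) = 0" using * dot mem by (metis (no_types, lifting))
      then show "pairing \<beta> (g * h) = 0"
        using pairing_multiple_modulus[OF qp c(2)] by (simp add: pairing_diff)
    next
      fix c
      assume *: "\<forall>h. pairing \<beta> (g * h) = 0" and "c \<in> code_of_ideal n a (ideal_gen n a {g})"
      then obtain h where c: "length c = n" "xn_minus n a dvd Poly c - g * h" using mem by blast
      then show "(\<Sum>i<n. b ! i * c ! i) = 0"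
        using pairing_multiple_modulus[OF qp c(2)] * dot[OF c(1)] by (simp add: pairing_diff)
    qed
    also have "\<dots> \<longleftrightarrow> (\<forall>j. seq_act g \<beta> j = 0)"
    proof
      assume "\<forall>h. pairing \<beta> (g * h) = 0"
      then show "\<forall>j. seq_act g \<beta> j = 0" by (metis pairing_mult pairing_monom mult_1)
    next
      assume "\<forall>j. seq_act g \<beta> j = 0"
      then have "seq_act g \<beta> = (\<lambda>j. 0)" by auto
      then show "\<forall>h. pairing \<beta> (g * h) = 0" by (simp add: pairing_mult)
    qed
    also have "\<dots> \<longleftrightarrow> xn_minus n a' dvd truncation n (seq_act g \<beta>)"
      using quasi_periodic_eq_0_iff[OF quasi_periodic_seq_act[OF qp] assms(2)]
      by (simp add: modulus_dvd_truncation_iff[OF assms(2)])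
    also have "\<dots> \<longleftrightarrow> xn_minus n a' dvd pcompose g ?y * Poly b"
      using dvd_add_right_iff[OF truncation_act[OF qp assms, of g]] truncation
      by (metis diff_add_cancel)
    finally show ?thesis .
  qed
  then show ?thesis by (auto simp: dual_code_def)
qed



lemma pcompose_power: "pcompose (f ^ k) g = pcompose f g ^ k"
  by (induction k) (simp_all add: pcompose_1 pcompose_mult)

lemma pcompose_monom: "pcompose (Polynomial.monom c k) g = smult c (g ^ k)"
  by (simp add: monom_altdef pcompose_smult pcompose_power pcompose_pCons)

text \<open>Associated residue classes have powers with the same annihilators.\<close>

lemma dvd_mult_power_iff:
  fixes q :: "'r::comm_ring_1"
  assumes "q dvd A - r * B" "q dvd B - t * A"
  shows "q dvd e * A ^ l * f \<longleftrightarrow> q dvd e * B ^ l * f"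
proof -
  have *: "q dvd e * A ^ l * f"
    if AB: "q dvd A - r * B" and B: "q dvd e * B ^ l * f" for A B r
  proof -
    have "q dvd A ^ l - (r * B) ^ l"
      using AB by (cases l) (simp_all only: power_0 diff_self dvd_0_right diff_power_eq_sum dvd_mult2)
    then have "q dvd (A ^ l - (r * B) ^ l) * (e * f) + r ^ l * (e * B ^ l * f)"
      using B by (intro dvd_add[OF dvd_mult2 dvd_mult])
    also have "(A ^ l - (r * B) ^ l) * (e * f) + r ^ l * (e * B ^ l * f) = e * A ^ l * f"
      by (simp add: power_mult_distrib algebra_simps)
    finally show ?thesis .
  qed
  show ?thesis using *[of A r B] *[of B t A] assms by blast
qed

text \<open>
  With \<open>y = 1/x\<close> and \<open>c' = 1/c\<close> one has \<open>y^k - c = - c y^k (x^k - c')\<close>, and the factor \<open>- c y^k\<close> is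
  a unit with inverse \<open>- c' x^k\<close>.
\<close>

lemma reciprocal_substitution:
  fixes a a' :: "'r::comm_ring_1"
  assumes "a * a' = 1" "n > 0" "c * c' = 1"
  defines "y \<equiv> Polynomial.monom a (n - 1)"
  shows "xn_minus n a' dvd e * (y ^ k - [:c:]) ^ l * f \<longleftrightarrow> xn_minus n a' dvd e * xn_minus k c' ^ l * f"
proof (rule dvd_mult_power_iff)
  define x where "x = ([:0, 1:] :: 'r poly)"
  have cc: "[:c:] * [:c':] = 1" using assms(3) by (simp add: one_pCons mult.commute)
  have xk: "Polynomial.monom 1 k = x ^ k" by (simp add: x_def monom_altdef)
  have "(y * x) ^ k - 1 = (y * x - 1) * (\<Sum>i<k. (y * x) ^ i)"
    by (rule power_diff_1_eq)
  then have dvd: "xn_minus n a' dvd y ^ k * x ^ k - 1"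
    using x_times_inverse[OF assms(1,2)] unfolding y_def x_def
    by (metis dvd_mult2 power_mult_distrib)
  have "y ^ k - [:c:] - (- [:c:] * y ^ k) * xn_minus k c'
      = [:c:] * (y ^ k * x ^ k - 1) + y ^ k * (1 - [:c:] * [:c':])"
    unfolding xk by (simp only: algebra_simps mult_1_left mult_1_right mult_minus_left mult_minus_right minus_diff_eq)
  then show "xn_minus n a' dvd y ^ k - [:c:] - (- [:c:] * y ^ k) * xn_minus k c'"
    using dvd by (simp only: cc diff_self mult_zero_right add_0_right dvd_mult)
  have "xn_minus k c' - (- [:c':] * x ^ k) * (y ^ k - [:c:])
      = [:c':] * (y ^ k * x ^ k - 1) + x ^ k * (1 - [:c:] * [:c':])"
    unfolding xk by (simp only: algebra_simps mult_1_left mult_1_right mult_minus_left mult_minus_right minus_diff_eq)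
  then show "xn_minus n a' dvd xn_minus k c' - (- [:c':] * x ^ k) * (y ^ k - [:c:])"
    using dvd by (simp only: cc diff_self mult_zero_right add_0_right dvd_mult)
qed

section \<open>The annihilator of \<open>u P^l\<close> over \<open>F + uF + vF + uvF\<close>\<close>

abbreviation scalar_poly :: "'a::field poly \<Rightarrow> 'a uv poly" where "scalar_poly \<equiv> map_poly scalar"

lemma scalar_hom:
  "scalar 0 = 0" "scalar 1 = 1" "scalar (a + b) = scalar a + scalar b"
  "scalar (a * b) = scalar a * scalar b" "scalar a = 0 \<longleftrightarrow> a = 0"
  by (simp_all add: scalar_def zero_uv_def one_uv_def)

lemma scalar_poly_pCons [simp]: "scalar_poly (pCons a f) = pCons (scalar a) (scalar_poly f)"
  by (cases "f = 0 \<and> a = 0") (auto simp: map_poly_pCons scalar_hom)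

lemma scalar_poly_add: "scalar_poly (f + g) = scalar_poly f + scalar_poly g"
  by (rule Polynomial.poly_eqI) (simp add: coeff_map_poly scalar_hom)

lemma scalar_poly_smult: "scalar_poly (smult a f) = smult (scalar a) (scalar_poly f)"
  by (induction f) (simp_all add: scalar_hom)

lemma scalar_poly_mult: "scalar_poly (f * g) = scalar_poly f * scalar_poly g"
  by (induction f) (simp_all add: scalar_poly_add scalar_poly_smult scalar_hom)

lemma scalar_poly_power: "scalar_poly (f ^ k) = scalar_poly f ^ k"
  by (induction k) (simp_all add: scalar_poly_mult scalar_hom)

lemma scalar_poly_modulus: "scalar_poly (xn_minus n a) = xn_minus n (scalar a)"
  by (rule Polynomial.poly_eqI)
    (auto simp: coeff_map_poly scalar_def zero_uv_def one_uv_def coeff_pCons split: nat.split)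

text \<open>
  \<open>1, u, v, u v\<close> is a basis of \<open>R[x]\<close> over \<open>F[x]\<close>: the next two lemmas are existence and
  uniqueness of coordinates.
\<close>

lemma uv_poly_decomposition:
  "\<exists>f0 f1 f2 f3. f = scalar_poly f0 + [:uu:] * scalar_poly f1 + [:vv:] * scalar_poly f2 + [:uu * vv:] * scalar_poly f3"
proof (induction f)
  case 0
  show ?case by (intro exI[of _ 0]) simp
next
  case (pCons x f)
  then obtain f0 f1 f2 f3
    where f: "f = scalar_poly f0 + [:uu:] * scalar_poly f1 + [:vv:] * scalar_poly f2 + [:uu * vv:] * scalar_poly f3" by blast
  obtain a b c d where x: "x = UV a b c d" by (cases x)
  show ?case
    unfolding f x
    by (rule exI[of _ "pCons a f0"], rule exI[of _ "pCons b f1"], rule exI[of _ "pCons c f2"],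
        rule exI[of _ "pCons d f3"]) (simp add: UV_expand mult.commute)
qed

lemma uv_poly_eq_iff:
  "scalar_poly f0 + [:uu:] * scalar_poly f1 + [:vv:] * scalar_poly f2 + [:uu * vv:] * scalar_poly f3
     = scalar_poly g0 + [:uu:] * scalar_poly g1 + [:vv:] * scalar_poly g2 + [:uu * vv:] * scalar_poly g3
   \<longleftrightarrow> f0 = g0 \<and> f1 = g1 \<and> f2 = g2 \<and> f3 = g3"
proof -
  have "Polynomial.coeff (scalar_poly f0 + [:uu:] * scalar_poly f1 + [:vv:] * scalar_poly f2 + [:uu * vv:] * scalar_poly f3) k
      = UV (Polynomial.coeff f0 k) (Polynomial.coeff f1 k) (Polynomial.coeff f2 k) (Polynomial.coeff f3 k)"
    for f0 f1 f2 f3 :: "'a poly" and k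
    by (simp add: coeff_map_poly scalar_hom) (simp add: scalar_def uu_def vv_def)
  then show ?thesis by (auto simp: Polynomial.poly_eq_iff)
qed

text \<open>
  Both \<open>P^(2q-l)\<close> and \<open>u\<close> kill \<open>u P^l\<close>, since \<open>P^(2q) = (b v + c u v)^2 = 0\<close> in the residue ring
  and \<open>u^2 = 0\<close>. For the converse, \<open>v\<close> is eliminated from \<open>f\<close> modulo \<open>u\<close> by means of
  \<open>b v \<equiv> P^q\<close>, which leaves some \<open>F\<close> with coefficients in the field. If \<open>u P^l F = Q h\<close>, the
  coordinates of \<open>h\<close> give \<open>P^l F = P^q h1\<close> and \<open>b h1 = P^q h3\<close>, hence \<open>P^(2q)\<close> divides \<open>P^l F\<close>.
\<close>

lemma annihilator_uu_power:
  fixes P :: "'a::field poly"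
  assumes Q: "Q = scalar_poly P ^ q - [:scalar b * vv + scalar c * (uu * vv):]"
    and "P \<noteq> 0" "b \<noteq> 0" "l \<le> 2 * q"
  shows "Q dvd [:uu:] * scalar_poly P ^ l * f \<longleftrightarrow> (\<exists>g h. Q dvd f - (g * scalar_poly P ^ (2 * q - l) + h * [:uu:]))"
proof -
  define U V B B' C where "U = [:uu :: 'a uv:]" and "V = [:vv :: 'a uv:]" and "B = scalar_poly [:b:]"
    and "B' = scalar_poly [:inverse b:]" and "C = scalar_poly [:c:]"
  note defs = U_def V_def B_def B'_def C_def
  have UU: "U * U = 0" and VV: "V * V = 0" and UV: "[:uu * vv:] = U * V"
    by (simp_all add: defs uu_def vv_def zero_uv_def)
  have BB: "B * B' = 1"
    using \<open>b \<noteq> 0\<close> by (simp add: defs one_pCons flip: scalar_hom)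
  have Q': "Q = scalar_poly P ^ q - B * V - C * (U * V)"
    by (simp add: Q defs algebra_simps)
  have UU0: "U * (U * x) = 0" for x using UU by (simp flip: mult.assoc)
  have VV0: "V * (V * x) = 0" for x using VV by (simp flip: mult.assoc)
  show ?thesis
  proof
    assume "\<exists>g h. Q dvd f - (g * scalar_poly P ^ (2 * q - l) + h * [:uu:])"
    then obtain g h k where f: "f = g * scalar_poly P ^ (2 * q - l) + h * U + Q * k"
      unfolding U_def[symmetric] by (metis add.commute diff_add_cancel dvd_def)
    have "scalar_poly P ^ l * scalar_poly P ^ (2 * q - l) = (Q + (B * V + C * (U * V))) ^ 2"
      using \<open>l \<le> 2 * q\<close> by (simp add: Q' flip: power_add power_mult) (simp add: mult.commute)
    also have "\<dots> = Q * (Q + 2 * (B * V + C * (U * V)))"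
      by (simp add: power2_eq_square algebra_simps VV VV0)
    finally have "scalar_poly P ^ l * scalar_poly P ^ (2 * q - l) = Q * (Q + 2 * (B * V + C * (U * V)))" .
    then have "U * scalar_poly P ^ l * f
        = Q * (U * g * (Q + 2 * (B * V + C * (U * V))) + U * scalar_poly P ^ l * k)"
      unfolding f by (simp add: algebra_simps UU0 UU)
    then show "Q dvd [:uu:] * scalar_poly P ^ l * f" by (simp add: U_def)
  next
    assume dvd: "Q dvd [:uu:] * scalar_poly P ^ l * f"
    obtain f0 f1 f2 f3 where f: "f = scalar_poly f0 + U * scalar_poly f1 + V * scalar_poly f2 + U * V * scalar_poly f3"
      using uv_poly_decomposition[of f] unfolding UV defs by blast
    \<comment> \<open>\<open>v f2\<close> is replaced by \<open>P^q f2 / b\<close>\<close>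
    define F where "F = f0 + [:inverse b:] * (P ^ q * f2)"
    have F: "scalar_poly F = scalar_poly f0 + B' * (scalar_poly P ^ q * scalar_poly f2)"
      unfolding F_def B'_def by (simp only: scalar_poly_add scalar_poly_mult scalar_poly_power)
    have "scalar_poly P ^ q = Q + B * V + C * (U * V)" by (simp add: Q')
    then have "scalar_poly F = scalar_poly f0 + B' * Q * scalar_poly f2 + (B * B') * V * scalar_poly f2 + B' * C * U * V * scalar_poly f2"
      unfolding F by (simp add: algebra_simps)
    then have fF: "f = scalar_poly F + (U * (scalar_poly f1 + V * scalar_poly f3 - B' * C * V * scalar_poly f2) - Q * (B' * scalar_poly f2))"
      unfolding f BB by (simp add: algebra_simps)
    have "U * scalar_poly P ^ l * f = U * (scalar_poly P ^ l * scalar_poly F) - Q * (U * scalar_poly P ^ l * B' * scalar_poly f2)"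
      by (subst fF) (simp add: algebra_simps UU0)
    then have "Q dvd U * (scalar_poly P ^ l * scalar_poly F)"
      using dvd unfolding U_def[symmetric] by (metis diff_add_cancel dvd_add dvd_triv_left)
    then obtain h where h: "U * scalar_poly (P ^ l * F) = Q * h"
      by (auto simp: scalar_poly_mult scalar_poly_power)
    obtain h0 h1 h2 h3 where h': "h = scalar_poly h0 + U * scalar_poly h1 + V * scalar_poly h2 + U * V * scalar_poly h3"
      using uv_poly_decomposition[of h] unfolding UV defs by blast
    have minus: "scalar_poly (x - y) = scalar_poly x - scalar_poly y" for x y :: "'a poly"
      using scalar_poly_add[of "x - y" y] by simp
    have "Q * h = scalar_poly (P ^ q * h0) + U * scalar_poly (P ^ q * h1) + V * scalar_poly (P ^ q * h2 - [:b:] * h0)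
        + U * V * scalar_poly (P ^ q * h3 - [:b:] * h1 - [:c:] * h0)"
      unfolding h' Q' minus scalar_poly_mult scalar_poly_power B_def[symmetric] C_def[symmetric]
      by (simp add: algebra_simps UU0 VV0 UU VV)
    with h have "scalar_poly 0 + [:uu:] * scalar_poly (P ^ l * F) + [:vv:] * scalar_poly 0 + [:uu * vv:] * scalar_poly 0
        = scalar_poly (P ^ q * h0) + [:uu:] * scalar_poly (P ^ q * h1) + [:vv:] * scalar_poly (P ^ q * h2 - [:b:] * h0)
        + [:uu * vv:] * scalar_poly (P ^ q * h3 - [:b:] * h1 - [:c:] * h0)"
      unfolding UV by (simp add: U_def V_def)
    then have *: "P ^ q * h0 = 0" "P ^ l * F = P ^ q * h1" "P ^ q * h3 - [:b:] * h1 - [:c:] * h0 = 0"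
      unfolding uv_poly_eq_iff by (metis, metis, metis)
    then have "h0 = 0" using \<open>P \<noteq> 0\<close> by simp
    then have "[:b:] * h1 = P ^ q * h3" using *(3) by simp
    then have "[:inverse b:] * ([:b:] * h1) = [:inverse b:] * (P ^ q * h3)" by simp
    then have "h1 = P ^ q * smult (inverse b) h3" using \<open>b \<noteq> 0\<close> by simp
    then have "P ^ l * F = P ^ (2 * q) * smult (inverse b) h3"
      using *(2) by (simp add: mult_2 power_add mult.assoc)
    also have "P ^ (2 * q) = P ^ l * P ^ (2 * q - l)"
      using \<open>l \<le> 2 * q\<close> by (simp flip: power_add)
    finally have "F = P ^ (2 * q - l) * smult (inverse b) h3"
      using \<open>P \<noteq> 0\<close> by (simp add: mult.assoc del: mult_smult_right)
    then have "scalar_poly F = scalar_poly (smult (inverse b) h3) * scalar_poly P ^ (2 * q - l)"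
      by (simp only: scalar_poly_mult scalar_poly_power mult.commute)
    then have "Q dvd f - (scalar_poly (smult (inverse b) h3) * scalar_poly P ^ (2 * q - l)
        + (scalar_poly f1 + V * scalar_poly f3 - B' * C * V * scalar_poly f2) * U)"
      by (subst fF) (simp add: algebra_simps)
    then show "\<exists>g h. Q dvd f - (g * scalar_poly P ^ (2 * q - l) + h * [:uu:])"
      unfolding U_def by blast
  qed
qed

section \<open>Frobenius powers over a finite field\<close>

text \<open>
  Multiplication by \<open>x \<noteq> 0\<close> permutes the nonzero elements, so their product does not change when it
  is multiplied by \<open>x\<close> to the number of nonzero elements.
\<close>

lemma field_power_card_eq_same:
  fixes x :: "'a::field"
  assumes "finite (UNIV :: 'a set)"
  shows "x ^ card (UNIV :: 'a set) = x"
proof (cases "x = 0")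
  case True
  have "card (UNIV :: 'a set) > 0" using assms by (rule finite_UNIV_card_ge_0)
  with True show ?thesis by (simp add: power_0_left)
next
  case False
  define A where "A = UNIV - {0 :: 'a}"
  have "bij_betw ((*) x) A A"
    by (rule bij_betwI[where g = "\<lambda>y. y / x"]) (use False in \<open>auto simp: A_def\<close>)
  then have "(\<Prod>y\<in>A. x * y) = \<Prod>A" by (rule prod.reindex_bij_betw[where g = "\<lambda>y. y"])
  then have "x ^ card A * \<Prod>A = \<Prod>A" by (simp add: prod.distrib)
  moreover have "\<Prod>A \<noteq> 0" using assms by (simp add: A_def)
  ultimately have "x ^ card A = 1" by simp
  moreover have "card (UNIV :: 'a set) = Suc (card A)"
    unfolding A_def by (rule card.remove[OF assms]) simp
  ultimately show ?thesis by simp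
qed

lemma field_power_card_power_eq_same:
  fixes x :: "'a::field"
  assumes "finite (UNIV :: 'a set)"
  shows "x ^ (card (UNIV :: 'a set) ^ k) = x"
  by (induction k) (simp_all add: power_mult field_power_card_eq_same[OF assms])

lemma CHAR_eq_of_card:
  assumes "Factorial_Ring.prime p" "card (UNIV :: 'a::field set) = p ^ m"
  shows "CHAR('a) = p"
proof -
  have dvd: "CHAR('a) dvd p ^ m" using CHAR_dvd_CARD[where 'a = 'a] assms(2) by simp
  moreover have "p ^ m > 0" using assms(1) prime_gt_0_nat by simp
  ultimately have "CHAR('a) > 0" by (metis dvd_0_left gr0I less_irrefl)
  then have "Factorial_Ring.prime CHAR('a)" by (rule prime_CHAR_semidom)
  with dvd assms(1) show ?thesis by (metis prime_dvd_power primes_dvd_imp_eq)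
qed

lemma CHAR_poly: "CHAR('a::comm_ring_1 poly) = CHAR('a)"
  by (rule CHAR_eqI) (simp_all add: of_nat_poly of_nat_eq_0_iff_char_dvd)

lemma modulus_power_prime_power:
  fixes a :: "'a::field"
  assumes "Factorial_Ring.prime p" "CHAR('a) = p"
  shows "xn_minus k a ^ (p ^ s) = xn_minus (k * p ^ s) (a ^ p ^ s)"
proof -
  have "Polynomial.monom 1 k ^ (p ^ s) = (xn_minus k a + [:a:]) ^ (p ^ s)" by simp
  also have "\<dots> = xn_minus k a ^ (p ^ s) + [:a:] ^ (p ^ s)"
    by (rule freshmans_dream') (use assms in \<open>simp_all add: CHAR_poly\<close>)
  finally show ?thesis by (simp add: Polynomial.monom_power poly_const_pow)
qed

section \<open>The dual of the code generated by \<open>u (x^3 - \<alpha>\<^sub>0)^l\<close>\<close>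

theorem theorem4p4:
  fixes p m s q0 r0 l :: nat
    and \<alpha>0 \<alpha>1 \<alpha>3 \<alpha>4 :: "'a::field"
    and \<alpha> :: "'a uv"
  assumes "Factorial_Ring.prime p" and "p \<noteq> 3" and "m > 0" and "s > 0"
    and "card (UNIV :: 'a set) = p ^ m"
    and "s = q0 * m + r0" and "r0 \<le> m - 1"
    and "\<alpha>1 \<noteq> 0" and "\<alpha>3 \<noteq> 0" and "\<alpha>4 \<noteq> 0"
    and "\<alpha>0 = \<alpha>1 ^ (p ^ (m - r0))"
    and "\<alpha> = scalar \<alpha>1 + scalar \<alpha>3 * vv + scalar \<alpha>4 * (uu * vv)"
    and "\<nexists>\<beta>. \<alpha> = \<beta> ^ 3"
    and "l \<le> 2 * p ^ s - 1"
  shows "dual_code (3 * p ^ s)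
           (code_of_ideal (3 * p ^ s) \<alpha>
             (ideal_gen (3 * p ^ s) \<alpha>
               {[:uu:] * (Polynomial.monom 1 3 - [:scalar \<alpha>0:]) ^ l}))
         = code_of_ideal (3 * p ^ s) (ring_inv \<alpha>)
             (ideal_gen (3 * p ^ s) (ring_inv \<alpha>)
               {(Polynomial.monom 1 3 - [:scalar (inverse \<alpha>0):]) ^ (2 * p ^ s - l), [:uu:]})"
proof -
  let ?n = "3 * p ^ s" and ?P = "xn_minus 3 (inverse \<alpha>0)" and ?U = "[:uu :: 'a uv:]"
  \<comment> \<open>\<open>1/(\<alpha>\<^sub>1 + w) = 1/\<alpha>\<^sub>1 - w/\<alpha>\<^sub>1^2\<close> for \<open>w = \<alpha>\<^sub>3 v + \<alpha>\<^sub>4 u v\<close>, as \<open>w^2 = 0\<close>\<close>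
  define b c where "b = - \<alpha>3 / \<alpha>1\<^sup>2" and "c = - \<alpha>4 / \<alpha>1\<^sup>2"
  define \<alpha>' where "\<alpha>' = UV (inverse \<alpha>1) 0 b c"
  have fin: "finite (UNIV :: 'a set)"
    using assms(1,5) by (metis card.infinite not_prime_0 power_not_zero)
  have p: "p > 0" using assms(1) by (rule prime_gt_0_nat)
  then have n: "?n > 0" by simp
  have \<alpha>: "\<alpha> = UV \<alpha>1 0 \<alpha>3 \<alpha>4"
    unfolding assms(12) by (simp add: scalar_def uu_def vv_def)
  have unit: "\<alpha> * \<alpha>' = 1"
    using assms(8) by (simp add: \<alpha> \<alpha>'_def b_def c_def one_uv_def power2_eq_square field_simps)
  then have inv: "ring_inv \<alpha> = \<alpha>'" by (rule ring_inv_eqI)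
  \<comment> \<open>the exponents add up to a multiple of \<open>m\<close>: \<open>(m - r0) + s = (q0 + 1) m\<close>\<close>
  have "\<alpha>0 ^ p ^ s = \<alpha>1 ^ (p ^ (m - r0) * p ^ s)"
    unfolding assms(11) by (simp only: power_mult)
  also have "p ^ (m - r0) * p ^ s = (p ^ m) ^ Suc q0"
    using assms(3,7) by (simp add: assms(6) flip: power_add power_mult) (simp add: algebra_simps)
  also have "\<alpha>1 ^ \<dots> = \<alpha>1"
    unfolding assms(5)[symmetric] by (rule field_power_card_power_eq_same[OF fin])
  finally have \<alpha>0: "\<alpha>0 ^ p ^ s = \<alpha>1" .
  then have "\<alpha>0 \<noteq> 0" using assms(8) p by auto
  have P: "scalar_poly ?P = xn_minus 3 (scalar (inverse \<alpha>0))" by (rule scalar_poly_modulus)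
  have "?P ^ (p ^ s) = xn_minus ?n (inverse \<alpha>1)"
    using modulus_power_prime_power[OF assms(1) CHAR_eq_of_card[OF assms(1,5)], of 3 "inverse \<alpha>0" s]
    by (simp add: power_inverse \<alpha>0)
  then have "scalar_poly ?P ^ (p ^ s) = xn_minus ?n (scalar (inverse \<alpha>1))"
    by (metis scalar_poly_power scalar_poly_modulus)
  then have Q: "xn_minus ?n \<alpha>' = scalar_poly ?P ^ (p ^ s) - [:scalar b * vv + scalar c * (uu * vv):]"
    by (simp add: \<alpha>'_def scalar_def uu_def vv_def)
  have "?P \<noteq> 0"
  proof
    assume "?P = 0"
    then have "Polynomial.coeff ?P 3 = 0" by simp
    then show False by (simp add: coeff_pCons numeral_3_eq_3)
  qed
  have "b \<noteq> 0" using assms(8,9) by (simp add: b_def)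
  have subst: "pcompose (?U * xn_minus 3 (scalar \<alpha>0) ^ l) (Polynomial.monom \<alpha> (?n - 1))
      = ?U * (Polynomial.monom \<alpha> (?n - 1) ^ 3 - [:scalar \<alpha>0:]) ^ l"
    by (simp add: pcompose_smult pcompose_power pcompose_diff pcompose_monom)
  have "xn_minus ?n \<alpha>' dvd pcompose (?U * xn_minus 3 (scalar \<alpha>0) ^ l) (Polynomial.monom \<alpha> (?n - 1)) * f
      \<longleftrightarrow> (\<exists>g h. xn_minus ?n \<alpha>' dvd f - (g * scalar_poly ?P ^ (2 * p ^ s - l) + h * ?U))" for f
  proof -
    have "scalar \<alpha>0 * scalar (inverse \<alpha>0) = 1"
      using \<open>\<alpha>0 \<noteq> 0\<close> by (simp flip: scalar_hom)
    then have "xn_minus ?n \<alpha>' dvd pcompose (?U * xn_minus 3 (scalar \<alpha>0) ^ l) (Polynomial.monom \<alpha> (?n - 1)) * f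
        \<longleftrightarrow> xn_minus ?n \<alpha>' dvd ?U * scalar_poly ?P ^ l * f"
      unfolding subst P by (rule reciprocal_substitution[OF unit n])
    also have "\<dots> \<longleftrightarrow> (\<exists>g h. xn_minus ?n \<alpha>' dvd f - (g * scalar_poly ?P ^ (2 * p ^ s - l) + h * ?U))"
      using assms(14) by (intro annihilator_uu_power[OF Q \<open>?P \<noteq> 0\<close> \<open>b \<noteq> 0\<close>]) simp
    finally show ?thesis .
  qed
  moreover have ex: "(\<exists>h\<in>poly_span.span {f, g}. R h) \<longleftrightarrow> (\<exists>c d. R (c * f + d * g))"
    for f g :: "'a uv poly" and R
    unfolding Bex_def mem_span_pair_iff by blast
  ultimately show ?thesis
    unfolding inv dual_code_principal[OF unit n]
    unfolding code_of_ideal_def cls_mem_ideal_gen_iff mem_span_insert_modulus_iff P[symmetric]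
    by (simp only: ex)
qed

end
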